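(* Let $T$ be a tree. For any positive integer $n\geq 4$, $p(P_n\Box T)=\frac{n_o(P_n\Box T)}{2}$.
   Context: All graphs are finite, simple and undirected. $P_n$ is the path on $n$ vertices. A path decomposition of a graph $G$ is a collection of edge-disjoint paths covering all edges of $G$; $p(G)$ denotes the minimum number of paths in a path decomposition of $G$. $n_o(G)$ denotes the number of vertices of odd degree in $G$. The Cartesian product $G\Box H$ has vertex set $V(G)\times V(H)$, with $(u_1,v_1)(u_2,v_2)$ an edge iff either $u_1u_2\in E(G)$ and $v_1=v_2$, or $v_1v_2\in E(H)$ and $u_1=u_2$. *)

theory Defs
  imports Complex_Main
begin

record 'a ugraph =
  verts :: "'a set"
  edges :: "'a set set"

definition simple_graph :: "'a ugraph \<Rightarrow> bool" where
  "simple_graph G \<longleftrightarrow> finite (verts G) \<and>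
     edges G \<subseteq> {{u, v} |u v. u \<in> verts G \<and> v \<in> verts G \<and> u \<noteq> v}"

definition subgraph :: "'a ugraph \<Rightarrow> 'a ugraph \<Rightarrow> bool" where
  "subgraph H G \<longleftrightarrow> verts H \<subseteq> verts G \<and> edges H \<subseteq> edges G"

definition degree :: "'a ugraph \<Rightarrow> 'a \<Rightarrow> nat" where
  "degree G v = card {e \<in> edges G. v \<in> e}"

definition num_odd :: "'a ugraph \<Rightarrow> nat" where
  "num_odd G = card {v \<in> verts G. odd (degree G v)}"

text \<open>The graph traced by a list of vertices; it is a path when the list is nonempty
  and has no repetitions.\<close>

definition list_graph :: "'a list \<Rightarrow> 'a ugraph" where
  "list_graph xs = \<lparr>verts = set xs, edges = {{xs ! i, xs ! Suc i} |i. Suc i < length xs}\<rparr>"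

text \<open>Single vertices count as paths; in a path decomposition they are merely superfluous.\<close>

definition is_path :: "'a ugraph \<Rightarrow> bool" where
  "is_path H \<longleftrightarrow> (\<exists>xs. xs \<noteq> [] \<and> distinct xs \<and> H = list_graph xs)"

definition is_cycle :: "'a ugraph \<Rightarrow> bool" where
  "is_cycle H \<longleftrightarrow> (\<exists>xs. 3 \<le> length xs \<and> distinct xs \<and>
     H = \<lparr>verts = set xs, edges = insert {last xs, hd xs} (edges (list_graph xs))\<rparr>)"

definition connected_graph :: "'a ugraph \<Rightarrow> bool" where
  "connected_graph G \<longleftrightarrow> verts G \<noteq> {} \<and>
     (\<forall>u \<in> verts G. \<forall>v \<in> verts G.
        \<exists>xs. xs \<noteq> [] \<and> distinct xs \<and> hd xs = u \<and> last xs = v \<and> subgraph (list_graph xs) G)"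

definition tree :: "'a ugraph \<Rightarrow> bool" where
  "tree G \<longleftrightarrow> simple_graph G \<and> connected_graph G \<and> \<not> (\<exists>H. subgraph H G \<and> is_cycle H)"

definition path_graph :: "nat \<Rightarrow> nat ugraph" where
  "path_graph n = list_graph [0..<n]"

definition cartesian_product :: "'a ugraph \<Rightarrow> 'b ugraph \<Rightarrow> ('a \<times> 'b) ugraph" where
  "cartesian_product G H =
     \<lparr>verts = verts G \<times> verts H,
      edges = {{(u1, v1), (u2, v2)} |u1 v1 u2 v2.
        (u1, v1) \<in> verts G \<times> verts H \<and> (u2, v2) \<in> verts G \<times> verts H \<and>
        ({u1, u2} \<in> edges G \<and> v1 = v2 \<or> {v1, v2} \<in> edges H \<and> u1 = u2)}\<rparr>"

definition path_decomposition :: "'a ugraph \<Rightarrow> 'a ugraph set \<Rightarrow> bool" where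
  "path_decomposition G D \<longleftrightarrow> finite D \<and>
     (\<forall>H \<in> D. is_path H \<and> subgraph H G) \<and>
     (\<forall>H \<in> D. \<forall>K \<in> D. H \<noteq> K \<longrightarrow> edges H \<inter> edges K = {}) \<and>
     (\<Union>H \<in> D. edges H) = edges G"

text \<open>Every finite simple graph has a path decomposition (into its single edges), so the
  minimum below is attained.\<close>

definition path_number :: "'a ugraph \<Rightarrow> nat" where
  "path_number G = (LEAST k. \<exists>D. path_decomposition G D \<and> card D = k)"

end

(* A decomposition in which every odd vertex is an end of exactly one path, and every even vertex
   of none, has n_o/2 paths; no decomposition does better, since each odd vertex must be an end of
   some path.  Such a decomposition is built by adding the leaves of T one at a time.  Let a leaf v
   be attached at u.
   If u had odd degree, the paths ending at the inner vertices (i,u) are prolonged to (i,v), and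
   the path (0,u),(0,v),...,(n-1,v),(n-1,u) is added.
   If u had even degree, the path ending at (0,u) is prolonged by (0,v),(1,v), the one ending at
   (n-1,u) by (n-1,v),...,(2,v), and the path (1,u),(1,v),(2,v),(2,u) and the single edges
   (i,u)(i,v) for 3 <= i <= n-2 are added; this needs n >= 4. *)
theory Submission
  imports Defs "HOL-Library.Disjoint_Sets"
begin

section \<open>Edge sets of vertex lists\<close>

text \<open>A recursive counterpart of the index-based edge set in \<open>list_graph\<close>, so
  that prepending, appending and reversing yield to list induction.\<close>

fun path_edges :: "'a list \<Rightarrow> 'a set set" where
  "path_edges (x # y # zs) = insert {x, y} (path_edges (y # zs))"
| "path_edges _ = {}"

lemma path_edges_Cons: "ys \<noteq> [] \<Longrightarrow> path_edges (x # ys) = insert {x, hd ys} (path_edges ys)"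
  by (cases ys) auto

lemma edges_list_graph: "edges (list_graph xs) = path_edges xs"
proof (induction xs rule: path_edges.induct)
  case (1 x y zs)
  have "{{(x # y # zs) ! i, (x # y # zs) ! Suc i} |i. Suc i < length (x # y # zs)} =
    insert {x, y} {{(y # zs) ! i, (y # zs) ! Suc i} |i. Suc i < length (y # zs)}"
    (is "?A = insert _ ?B")
  proof
    show "?A \<subseteq> insert {x, y} ?B"
    proof
      fix e assume "e \<in> ?A"
      then obtain i where "e = {(x # y # zs) ! i, (x # y # zs) ! Suc i}"
        "Suc i < length (x # y # zs)" by blast
      then show "e \<in> insert {x, y} ?B" by (cases i) auto
    qed
    show "insert {x, y} ?B \<subseteq> ?A"
    proof
      fix e assume "e \<in> insert {x, y} ?B"
      then consider "e = {x, y}" | i where "e = {(y # zs) ! i, (y # zs) ! Suc i}"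
        "Suc i < length (y # zs)" by blast
      then show "e \<in> ?A"
      proof cases
        case 1
        then show ?thesis by (intro CollectI exI[of _ 0]) auto
      next
        case (2 i)
        then show ?thesis by (intro CollectI exI[of _ "Suc i"]) auto
      qed
    qed
  qed
  then show ?case using 1 by (simp add: list_graph_def)
qed (auto simp: list_graph_def)

lemma verts_list_graph [simp]: "verts (list_graph xs) = set xs"
  by (simp add: list_graph_def)

lemma path_edges_subset: "e \<in> path_edges xs \<Longrightarrow> e \<subseteq> set xs"
  by (induction xs rule: path_edges.induct) auto

lemma finite_path_edges: "finite (path_edges xs)"
  by (induction xs rule: path_edges.induct) auto

lemma path_edges_nonempty: "2 \<le> length xs \<Longrightarrow> path_edges xs \<noteq> {}"
  by (cases xs rule: path_edges.cases) auto

text \<open>A single vertex lies on no edge, hence the length bound. This lets freshness of vertices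
  be expressed through the edge set alone, as \<open>\<Union>E\<close>.\<close>

lemma path_edges_cover: "2 \<le> length xs \<Longrightarrow> set xs \<subseteq> \<Union>(path_edges xs)"
proof (induction xs rule: path_edges.induct)
  case (1 x y zs)
  then show ?case by (cases zs) auto
qed auto

text \<open>Repeating \<open>last xs\<close> at the front of the second part accounts for the edge
  at the junction.\<close>

lemma path_edges_append:
  "xs \<noteq> [] \<Longrightarrow> path_edges (xs @ ys) = path_edges xs \<union> path_edges (last xs # ys)"
  by (induction xs rule: path_edges.induct) auto

lemma path_edges_rev: "path_edges (rev xs) = path_edges xs"
proof (induction xs rule: path_edges.induct)
  case (1 x y zs)
  then show ?case
    using path_edges_append[of "rev zs @ [y]" "[x]"] by (auto simp: insert_commute)
qed auto

text \<open>Used for the columns of the grid. Truncated subtraction is harmless: for fewer than two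
  vertices both sides are empty.\<close>

lemma path_edges_map_upt:
  "path_edges (map g [a..<b]) = (\<lambda>i. {g i, g (Suc i)}) ` {a..<b - 1}"
proof (induction b)
  case (Suc b)
  show ?case
  proof (cases "a < b")
    case True
    then have "path_edges (map g [a..<Suc b]) =
        path_edges (map g [a..<b]) \<union> {{g (b - 1), g b}}"
      using path_edges_append[of "map g [a..<b]" "[g b]"] by (simp add: last_map)
    moreover have "{a..<Suc b - 1} = insert (b - 1) {a..<b - 1}" "Suc (b - 1) = b"
      using True by auto
    ultimately show ?thesis using Suc by simp
  next
    case False
    then show ?thesis by auto
  qed
qed simp

text \<open>Prepending \<open>x\<close> adds one new edge, which flips the parity at
  \<open>x\<close> and at \<open>y\<close> only: \<open>x\<close> becomes an end, and
  \<open>y\<close> stops being one unless it is also the last vertex.\<close>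

lemma odd_path_degree_iff:
  assumes "distinct xs" "2 \<le> length xs"
  shows "odd (card {e \<in> path_edges xs. v \<in> e}) \<longleftrightarrow> v = hd xs \<or> v = last xs"
  using assms
proof (induction xs rule: path_edges.induct)
  case (1 x y zs)
  have new: "{x, y} \<notin> path_edges (y # zs)"
    using 1(2) path_edges_subset[of "{x, y}" "y # zs"] by auto
  have fin: "finite {e \<in> path_edges (y # zs). v \<in> e}"
    using finite_path_edges[of "y # zs"] by simp
  have split: "{e \<in> path_edges (x # y # zs). v \<in> e} = (if v = x \<or> v = y
      then insert {x, y} {e \<in> path_edges (y # zs). v \<in> e} else {e \<in> path_edges (y # zs). v \<in> e})"
    by auto
  have parity: "odd (card {e \<in> path_edges (x # y # zs). v \<in> e}) \<longleftrightarrow>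
      (odd (card {e \<in> path_edges (y # zs). v \<in> e}) \<noteq> (v = x \<or> v = y))"
  proof (cases "v = x \<or> v = y")
    case True
    then show ?thesis unfolding split using fin new by simp
  next
    case False
    then show ?thesis unfolding split by simp
  qed
  show ?case
  proof (cases zs)
    case Nil
    then show ?thesis using parity by auto
  next
    case (Cons z zs')
    then have "last zs \<in> set zs" "last (y # zs) = last zs" by auto
    moreover from this have "last zs \<noteq> x" "last zs \<noteq> y" "x \<noteq> y" using 1(2) by auto
    moreover have "odd (card {e \<in> path_edges (y # zs). v \<in> e}) \<longleftrightarrow> v = y \<or> v = last zs"
      using 1(1) 1(2) Cons \<open>last (y # zs) = last zs\<close> by simp
    ultimately show ?thesis unfolding parity by auto
  qed
qed auto

section \<open>Systems of edge-disjoint paths with pairwise disjoint ends\<close>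

definition path_ends :: "'a list \<Rightarrow> 'a set" where
  "path_ends xs = {hd xs, last xs}"

text \<open>The set \<open>S\<close> consists of the ends of the paths, no two paths sharing an end; it is then
  automatically the set of vertices of odd degree.\<close>

definition path_system :: "'a list set \<Rightarrow> 'a set set \<Rightarrow> 'a set \<Rightarrow> bool" where
  "path_system L E S \<longleftrightarrow> finite L \<and> (\<forall>xs\<in>L. distinct xs \<and> 2 \<le> length xs) \<and>
     disjoint_family_on path_edges L \<and> (\<Union>xs\<in>L. path_edges xs) = E \<and>
     disjoint_family_on path_ends L \<and> (\<Union>xs\<in>L. path_ends xs) = S"

text \<open>Hides the paths: the induction over leaves only has to track which edges are covered and
  which vertices are ends.\<close>

definition linked :: "'a set set \<Rightarrow> 'a set \<Rightarrow> bool" where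
  "linked E S \<longleftrightarrow> (\<exists>L. path_system L E S)"

lemma path_system_edges_disjoint:
  "path_system L E S \<Longrightarrow> xs \<in> L \<Longrightarrow> ys \<in> L \<Longrightarrow> xs \<noteq> ys \<Longrightarrow> path_edges xs \<inter> path_edges ys = {}"
  unfolding path_system_def disjoint_family_on_def by blast

lemma path_system_ends_disjoint:
  "path_system L E S \<Longrightarrow> xs \<in> L \<Longrightarrow> ys \<in> L \<Longrightarrow> xs \<noteq> ys \<Longrightarrow> path_ends xs \<inter> path_ends ys = {}"
  unfolding path_system_def disjoint_family_on_def by blast

lemma path_system_insert:
  assumes "path_system L E S" "distinct xs" "2 \<le> length xs"
    and "path_edges xs \<inter> E = {}" "path_ends xs \<inter> S = {}"
  shows "path_system (insert xs L) (E \<union> path_edges xs) (S \<union> path_ends xs)"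
proof -
  \<comment> \<open>Its ends form a nonempty set disjoint from \<open>S\<close>, whereas the ends of
    a member of \<open>L\<close> lie in \<open>S\<close>.\<close>
  have "xs \<notin> L" using assms by (auto simp: path_system_def path_ends_def)
  then show ?thesis using assms
    by (auto simp: path_system_def disjoint_family_on_insert)
qed

lemma path_system_remove:
  assumes "path_system L E S" "xs \<in> L"
  shows "path_system (L - {xs}) (E - path_edges xs) (S - path_ends xs)"
proof -
  have "(\<Union>ys\<in>L - {xs}. path_edges ys) = E - path_edges xs"
    using assms path_system_edges_disjoint[OF assms] unfolding path_system_def by blast
  moreover have "(\<Union>ys\<in>L - {xs}. path_ends ys) = S - path_ends xs"
    using assms path_system_ends_disjoint[OF assms] unfolding path_system_def by blast
  moreover have "disjoint_family_on path_edges (L - {xs})" "disjoint_family_on path_ends (L - {xs})"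
    using assms disjoint_family_on_mono[of "L - {xs}" L] by (auto simp only: path_system_def)
  ultimately show ?thesis using assms unfolding path_system_def by simp
qed

lemma linked_empty: "linked {} {}"
  unfolding linked_def path_system_def by (intro exI[of _ "{}"]) (auto simp: disjoint_family_on_def)

lemma linked_add:
  assumes "linked E S" "distinct xs" "2 \<le> length xs"
    and "path_edges xs \<inter> E = {}" "path_ends xs \<inter> S = {}"
  shows "linked (E \<union> path_edges xs) (S \<union> path_ends xs)"
  using assms path_system_insert unfolding linked_def by metis

text \<open>The path with end \<open>x\<close> is turned so that it finishes at \<open>x\<close>,
  and \<open>ys\<close> is appended. As \<open>ys\<close> avoids every vertex on an edge of
  \<open>E\<close>, the result is again a path; the end \<open>x\<close> is replaced by
  \<open>last ys\<close>.\<close>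

lemma linked_extend:
  assumes "linked E S" "x \<in> S" "distinct ys" "ys \<noteq> []"
    and fresh: "set ys \<inter> \<Union>E = {}"
  shows "linked (E \<union> path_edges (x # ys)) (insert (last ys) (S - {x}))"
proof -
  obtain L where L: "path_system L E S" using assms unfolding linked_def by blast
  then obtain xs where xs: "xs \<in> L" "x \<in> path_ends xs"
    using assms(2) unfolding path_system_def by blast
  then have d: "distinct xs" "2 \<le> length xs" "path_edges xs \<subseteq> E" "path_ends xs \<subseteq> S"
    using L unfolding path_system_def by auto
  define zs where "zs = (if x = last xs then xs else rev xs)"
  have zs: "distinct zs" "2 \<le> length zs" "path_edges zs = path_edges xs"
    "path_ends zs = path_ends xs" "last zs = x" "zs \<noteq> []"
    using d xs(2) by (auto simp: zs_def path_edges_rev path_ends_def hd_rev last_rev)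
  \<comment> \<open>The other end must survive when \<open>x\<close> is removed from
    \<open>S\<close>.\<close>
  have hd: "hd zs \<noteq> x" 
    using zs by (cases zs) (auto split: if_splits)
  have ys: "set ys \<inter> set zs = {}" using fresh zs path_edges_cover[of zs] d by blast
  \<comment> \<open>Every end lies on a path with at least one edge, so it belongs to
    \<open>\<Union>E\<close>, which \<open>ys\<close> avoids.\<close>
  have S: "last ys \<notin> S"
  proof
    assume "last ys \<in> S"
    then obtain ws where "ws \<in> L" "last ys \<in> path_ends ws" using L unfolding path_system_def by blast
    moreover then have "2 \<le> length ws" "path_edges ws \<subseteq> E" using L by (auto simp: path_system_def)
    moreover then have "ws \<noteq> []" by auto
    ultimately have "last ys \<in> set ws" "2 \<le> length ws" "path_edges ws \<subseteq> E"
      by (auto simp: path_ends_def)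
    then show False using path_edges_cover[of ws] fresh last_in_set[OF assms(4)] by blast
  qed
  \<comment> \<open>Each edge added meets \<open>ys\<close>, so it cannot belong to
    \<open>E\<close>.\<close>
  have "\<exists>y\<in>e. y \<in> set ys" if "e \<in> path_edges (x # ys)" for e
    using that by (induction "x # ys" arbitrary: x ys rule: path_edges.induct) auto
  then have E: "path_edges (x # ys) \<inter> E = {}" using fresh by blast
  have new: "path_edges (zs @ ys) = path_edges xs \<union> path_edges (x # ys)"
    using zs by (simp add: path_edges_append)
  have ends: "path_ends (zs @ ys) = {hd zs, last ys}"
    using zs assms by (simp add: path_ends_def)
  have "path_system (insert (zs @ ys) (L - {xs}))
      (E - path_edges xs \<union> path_edges (zs @ ys)) (S - path_ends xs \<union> path_ends (zs @ ys))"
  proof (rule path_system_insert[OF path_system_remove[OF L xs(1)]])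
    show "distinct (zs @ ys)" using zs assms ys by auto
    show "2 \<le> length (zs @ ys)" using zs by simp
    show "path_edges (zs @ ys) \<inter> (E - path_edges xs) = {}" using E new by blast
    show "path_ends (zs @ ys) \<inter> (S - path_ends xs) = {}"
      using S zs(4) unfolding ends by (auto simp: path_ends_def)
  qed
  moreover have "E - path_edges xs \<union> path_edges (zs @ ys) = E \<union> path_edges (x # ys)"
    using new d by blast
  moreover have "path_ends xs = {hd zs, x}" using zs by (auto simp: path_ends_def)
  then have "S - path_ends xs \<union> path_ends (zs @ ys) = insert (last ys) (S - {x})"
    using d(4) hd ends by auto
  ultimately show ?thesis unfolding linked_def by metis
qed

text \<open>Iterates \<open>linked_extend\<close> with one-vertex extensions. The edges already
  added meet only \<open>A\<close> and its image, so injectivity of \<open>f\<close> and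
  disjointness of its image from \<open>A\<close> keep the next \<open>f x\<close> fresh.\<close>

lemma linked_extend_many:
  assumes "finite A" "linked E S" "A \<subseteq> S" "inj_on f A" "f ` A \<inter> (\<Union>E \<union> A) = {}"
  shows "linked (E \<union> (\<lambda>x. {x, f x}) ` A) (f ` A \<union> (S - A))"
  using assms
proof (induction A rule: finite_induct)
  case (insert x A)
  have "linked (E \<union> (\<lambda>x. {x, f x}) ` A \<union> path_edges (x # [f x]))
      (insert (last [f x]) (f ` A \<union> (S - A) - {x}))"
  proof (rule linked_extend)
    show "linked (E \<union> (\<lambda>x. {x, f x}) ` A) (f ` A \<union> (S - A))"
      using insert by (intro insert.IH) auto
  qed (use insert in \<open>auto simp: inj_on_def\<close>)
  moreover have "insert (last [f x]) (f ` A \<union> (S - A) - {x}) = f ` insert x A \<union> (S - insert x A)"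
    using insert by auto
  ultimately show ?case by (simp add: Un_insert_right)
qed simp

text \<open>Here each edge \<open>{x, f x}\<close> becomes a path of its own, so both
  \<open>x\<close> and \<open>f x\<close> become ends.\<close>

lemma linked_add_many:
  assumes "finite A" "linked E S" "inj_on f A" "f ` A \<inter> A = {}"
    and "(A \<union> f ` A) \<inter> S = {}" "(\<lambda>x. {x, f x}) ` A \<inter> E = {}"
  shows "linked (E \<union> (\<lambda>x. {x, f x}) ` A) (S \<union> A \<union> f ` A)"
  using assms
proof (induction A rule: finite_induct)
  case (insert x A)
  have "linked (E \<union> (\<lambda>x. {x, f x}) ` A \<union> path_edges [x, f x])
      (S \<union> A \<union> f ` A \<union> path_ends [x, f x])"
  proof (rule linked_add)
    show "linked (E \<union> (\<lambda>x. {x, f x}) ` A) (S \<union> A \<union> f ` A)"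
      using insert by (intro insert.IH) auto
  qed (use insert in \<open>auto simp: inj_on_def path_ends_def doubleton_eq_iff\<close>)
  moreover have "S \<union> A \<union> f ` A \<union> path_ends [x, f x] = S \<union> insert x A \<union> f ` insert x A"
    by (auto simp: path_ends_def)
  ultimately show ?case by (simp add: Un_insert_right)
qed simp

section \<open>Parity of degrees and the value of the path number\<close>

text \<open>Each path has two different ends, and no end is shared.\<close>

lemma path_system_card:
  assumes "path_system L E S"
  shows "card S = 2 * card L"
proof -
  have 2: "card (path_ends xs) = 2" if "xs \<in> L" for xs
  proof -
    have "distinct xs" "2 \<le> length xs" using assms that by (auto simp: path_system_def)
    then have "hd xs \<noteq> last xs" by (cases xs) (auto split: if_splits)
    then show ?thesis by (simp add: path_ends_def)
  qed
  have "card S = (\<Sum>xs\<in>L. card (path_ends xs))"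
    using assms by (auto simp: path_system_def path_ends_def disjoint_family_on_def
        intro!: card_UN_disjoint)
  then show ?thesis using 2 by simp
qed

lemma degree_decomposition:
  assumes "finite D" "disjoint_family_on f D" "(\<Union>x\<in>D. f x) = E" "\<And>x. x \<in> D \<Longrightarrow> finite (f x)"
  shows "card {e \<in> E. v \<in> e} = (\<Sum>x\<in>D. card {e \<in> f x. v \<in> e})"
proof -
  have "{e \<in> E. v \<in> e} = (\<Union>x\<in>D. {e \<in> f x. v \<in> e})" using assms(3) by auto
  then show ?thesis using assms
    by (simp only:) (intro card_UN_disjoint, auto simp: disjoint_family_on_def)
qed

text \<open>Exactly one path ends at \<open>v\<close> and contributes an odd number of edges there;
  all the others contribute an even number.\<close>

lemma path_system_odd:
  assumes "path_system L E S" "v \<in> S"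
  shows "odd (card {e \<in> E. v \<in> e})"
proof -
  have fin: "finite L" using assms by (simp add: path_system_def)
  obtain xs where xs: "xs \<in> L" "v \<in> path_ends xs" using assms by (auto simp: path_system_def)
  have odd_iff: "odd (card {e \<in> path_edges ys. v \<in> e}) \<longleftrightarrow> v \<in> path_ends ys" if "ys \<in> L" for ys
    using odd_path_degree_iff[of ys v] assms that by (auto simp: path_system_def path_ends_def)
  have "v \<notin> path_ends ys" if "ys \<in> L - {xs}" for ys
    using that xs path_system_ends_disjoint[OF assms(1), of xs ys] by blast
  then have "even (\<Sum>ys\<in>L - {xs}. card {e \<in> path_edges ys. v \<in> e})"
    using odd_iff by (intro dvd_sum) auto
  moreover have "card {e \<in> E. v \<in> e} = (\<Sum>ys\<in>L. card {e \<in> path_edges ys. v \<in> e})"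
    using assms by (intro degree_decomposition) (auto simp: path_system_def finite_path_edges)
  ultimately show ?thesis using odd_iff[OF xs(1)] xs fin by (simp add: sum.remove)
qed

text \<open>At a vertex where no path ends, every path contributes an even number to the degree. So
  the odd vertices are among the ends, at most two per path.\<close>

lemma path_number_lower_bound:
  assumes "path_decomposition G D"
  shows "num_odd G \<le> 2 * card D"
proof -
  have fin: "finite D" and paths: "\<forall>H\<in>D. \<exists>xs. xs \<noteq> [] \<and> distinct xs \<and> H = list_graph xs"
    using assms unfolding path_decomposition_def is_path_def by blast+
  obtain p where p: "p H \<noteq> [] \<and> distinct (p H) \<and> H = list_graph (p H)" if "H \<in> D" for H
    using bchoice[OF paths] by blast
  have ed: "edges H = path_edges (p H)" if "H \<in> D" for H
    using p[OF that] edges_list_graph by metis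
  have deg: "degree G v = (\<Sum>H\<in>D. card {e \<in> path_edges (p H). v \<in> e})" for v
    unfolding degree_def using assms ed
    by (intro degree_decomposition)
      (auto simp: path_decomposition_def disjoint_family_on_def finite_path_edges)
  have even: "even (card {e \<in> path_edges (p H). v \<in> e})" if "H \<in> D" "v \<notin> path_ends (p H)" for H v
  proof (cases "2 \<le> length (p H)")
    case True
    then show ?thesis using odd_path_degree_iff[of "p H" v] p[OF that(1)] that(2)
      by (auto simp: path_ends_def)
  next
    case False
    \<comment> \<open>A single vertex has no edges, so its contribution is 0.\<close>
    then show ?thesis by (cases "p H" rule: path_edges.cases) auto
  qed
  have "{v \<in> verts G. odd (degree G v)} \<subseteq> (\<Union>H\<in>D. path_ends (p H))"
  proof
    fix v assume "v \<in> {v \<in> verts G. odd (degree G v)}"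
    then have "\<not> even (\<Sum>H\<in>D. card {e \<in> path_edges (p H). v \<in> e})" using deg by simp
    then show "v \<in> (\<Union>H\<in>D. path_ends (p H))"
      using even dvd_sum[of D 2 "\<lambda>H. card {e \<in> path_edges (p H). v \<in> e}"] by blast
  qed
  then have "num_odd G \<le> card (\<Union>H\<in>D. path_ends (p H))"
    unfolding num_odd_def using fin by (intro card_mono) (auto simp: path_ends_def)
  also have "\<dots> \<le> (\<Sum>H\<in>D. card (path_ends (p H)))" using fin by (rule card_UN_le)
  also have "\<dots> \<le> (\<Sum>H\<in>D. 2)"
    by (intro sum_mono) (auto simp: path_ends_def card_insert_le_m1)
  finally show ?thesis by simp
qed

text \<open>The system is a decomposition into \<open>card S / 2\<close> paths. Its ends are odd
  vertices, so the lower bound shows both that it is minimal and that it has exactly half as many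
  paths as there are odd vertices.\<close>

lemma path_number_linked:
  assumes "simple_graph G" "linked (edges G) S"
  shows "2 * path_number G = num_odd G"
proof -
  obtain L where L: "path_system L (edges G) S" using assms unfolding linked_def by blast
  have verts: "\<Union>(edges G) \<subseteq> verts G" "finite (verts G)" 
    using assms(1) unfolding simple_graph_def by auto
  have sub: "set xs \<subseteq> verts G" if "xs \<in> L" for xs
  proof -
    have "path_edges xs \<subseteq> edges G" "2 \<le> length xs" using L that by (auto simp: path_system_def)
    then show ?thesis using path_edges_cover[of xs] verts(1) by blast
  qed
  \<comment> \<open>Needed to count graphs instead of lists. Two lists with the same graph, such as
    a list and its reverse, would share their edges, and there is at least one edge.\<close>
  have inj: "inj_on list_graph L"
  proof (rule inj_onI)
    fix xs ys assume *: "xs \<in> L" "ys \<in> L" "list_graph xs = list_graph ys"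
    then have "path_edges xs = path_edges ys" using edges_list_graph by metis
    moreover have "path_edges xs \<noteq> {}" using * L path_edges_nonempty by (auto simp: path_system_def)
    ultimately show "xs = ys" using * path_system_edges_disjoint[OF L, of xs ys] by blast
  qed
  have dec: "path_decomposition G (list_graph ` L)"
    unfolding path_decomposition_def
  proof (intro conjI ballI impI)
    fix H assume "H \<in> list_graph ` L"
    then obtain xs where xs: "xs \<in> L" "H = list_graph xs" by blast
    then have "distinct xs" "xs \<noteq> []" using L by (auto simp: path_system_def)
    then show "is_path H" unfolding is_path_def using xs by blast
    show "subgraph H G" using xs sub L 
      by (auto simp: subgraph_def edges_list_graph path_system_def)
  next
    fix H K assume *: "H \<in> list_graph ` L" "K \<in> list_graph ` L" "H \<noteq> K"
    then obtain xs ys where "xs \<in> L" "H = list_graph xs" "ys \<in> L" "K = list_graph ys" "xs \<noteq> ys"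
      by blast
    then show "edges H \<inter> edges K = {}" using L
      by (simp add: edges_list_graph path_system_def disjoint_family_on_def)
  qed (use L in \<open>auto simp: edges_list_graph path_system_def\<close>)
  have "S \<subseteq> {v \<in> verts G. odd (degree G v)}"
  proof
    fix v assume v: "v \<in> S"
    then have odd: "odd (degree G v)" using path_system_odd[OF L] by (simp add: degree_def)
    obtain xs where "xs \<in> L" "v \<in> path_ends xs" using v L by (auto simp: path_system_def)
    moreover then have "xs \<noteq> []" using L by (auto simp: path_system_def)
    ultimately have "v \<in> verts G" using sub[of xs] by (auto simp: path_ends_def)
    with odd show "v \<in> {v \<in> verts G. odd (degree G v)}" by simp
  qed
  then have "2 * card L \<le> num_odd G"
    unfolding num_odd_def path_system_card[OF L, symmetric] using verts(2) by (intro card_mono) auto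
  moreover have "path_number G = card L"
    unfolding path_number_def
  proof (rule Least_equality)
    show "\<exists>D. path_decomposition G D \<and> card D = card L"
      using dec card_image[OF inj] by blast
    \<comment> \<open>Combines \<open>2 * card L \<le> num_odd G\<close>, held in
      \<open>calculation\<close>, with \<open>num_odd G \<le> 2 * k\<close>.\<close>
    show "card L \<le> k" if "\<exists>D. path_decomposition G D \<and> card D = k" for k
      using that path_number_lower_bound calculation by fastforce
  qed
  moreover have "num_odd G \<le> 2 * card L"
    using path_number_lower_bound[OF dec] card_image[OF inj] by simp
  ultimately show ?thesis by simp
qed

section \<open>Trees built by adding leaves\<close>

text \<open>Supplies the induction principle for trees: start from one vertex and attach a new leaf
  \<open>v\<close> at an old vertex \<open>u\<close>.\<close>

inductive leaf_built :: "'a set \<Rightarrow> 'a set set \<Rightarrow> bool" where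
  single: "leaf_built {x} {}"
| leaf: "leaf_built V F \<Longrightarrow> u \<in> V \<Longrightarrow> v \<notin> V \<Longrightarrow> leaf_built (insert v V) (insert {u, v} F)"

lemma leaf_built_wf:
  assumes "leaf_built V F"
  shows "finite V \<and> V \<noteq> {} \<and> finite F \<and> (\<forall>e\<in>F. \<exists>u\<in>V. \<exists>v\<in>V. e = {u, v} \<and> u \<noteq> v)"
  using assms
proof induction
  case (leaf V F u v)
  then show ?case by fastforce
qed auto

text \<open>Supplies the path inside \<open>V\<close> that closes a cycle in the proof of
  \<open>tree_leaf_built\<close>. A path to the new leaf \<open>v\<close> is a path to
  \<open>u\<close> followed by \<open>v\<close>.\<close>

lemma leaf_built_connected:
  assumes "leaf_built V F" "a \<in> V" "b \<in> V"
  shows "\<exists>xs. xs \<noteq> [] \<and> distinct xs \<and> hd xs = a \<and> last xs = b \<and> set xs \<subseteq> V \<and> path_edges xs \<subseteq> F"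
  using assms
proof (induction arbitrary: a b)
  case (single x)
  then show ?case by (intro exI[of _ "[x]"]) auto
next
  case (leaf V F u v)
  have to_v: "\<exists>xs. xs \<noteq> [] \<and> distinct xs \<and> hd xs = c \<and> last xs = v \<and> set xs \<subseteq> insert v V \<and>
      path_edges xs \<subseteq> insert {u, v} F" if c: "c \<in> V" for c
  proof -
    obtain xs where "xs \<noteq> []" "distinct xs" "hd xs = c" "last xs = u" "set xs \<subseteq> V" "path_edges xs \<subseteq> F"
      using leaf.IH[OF c leaf.hyps(2)] by blast
    then show ?thesis using leaf.hyps
      by (intro exI[of _ "xs @ [v]"]) (auto simp: path_edges_append)
  qed
  consider "a = v" "b = v" | "a \<in> V" "b = v" | "a = v" "b \<in> V" | "a \<in> V" "b \<in> V"
    using leaf.prems by blast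
  then show ?case
  proof cases
    case 1
    then show ?thesis by (intro exI[of _ "[v]"]) auto
  next
    case 2
    then show ?thesis using to_v by simp
  next
    case 3
    then obtain xs where "xs \<noteq> []" "distinct xs" "hd xs = b" "last xs = v" "set xs \<subseteq> insert v V"
      "path_edges xs \<subseteq> insert {u, v} F" using to_v by blast
    then show ?thesis using 3
      by (intro exI[of _ "rev xs"]) (auto simp: path_edges_rev hd_rev last_rev)
  next
    case 4
    then show ?thesis using leaf.IH[of a b] by blast
  qed
qed

lemma path_crosses:
  assumes "xs \<noteq> []" "hd xs \<in> W" "last xs \<notin> W"
  shows "\<exists>u v. {u, v} \<in> path_edges xs \<and> u \<in> W \<and> v \<notin> W"
  using assms
proof (induction xs rule: path_edges.induct)
  case (1 x y zs)
  then show ?case by (cases "y \<in> W") auto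
qed auto

text \<open>Take a largest vertex set \<open>W\<close> whose induced subgraph is built from leaves.
  If a vertex were missing, connectedness would give an edge leaving \<open>W\<close>, and
  acyclicity would make its outer end a leaf over \<open>W\<close>, so \<open>W\<close> could
  grow.\<close>

lemma tree_leaf_built:
  assumes "tree T"
  shows "leaf_built (verts T) (edges T)"
proof -
  have fin: "finite (verts T)"
    and edges: "edges T \<subseteq> {{u, v} |u v. u \<in> verts T \<and> v \<in> verts T \<and> u \<noteq> v}"
    and conn: "connected_graph T" and acyclic: "\<not> (\<exists>H. subgraph H T \<and> is_cycle H)"
    using assms by (auto simp: tree_def simple_graph_def)
  define P where "P = (\<lambda>W. W \<subseteq> verts T \<and> leaf_built W {e \<in> edges T. e \<subseteq> W})"
  obtain r where r: "r \<in> verts T" using conn by (auto simp: connected_graph_def)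
  have "{e \<in> edges T. e \<subseteq> {r}} = {}" using edges by fastforce
  then have "leaf_built {r} {e \<in> edges T. e \<subseteq> {r}}" by (simp only: leaf_built.single)
  then have "P {r}" using r by (simp add: P_def)
  moreover have "\<forall>W. P W \<longrightarrow> card W < Suc (card (verts T))"
    using fin by (auto simp: P_def less_Suc_eq_le card_mono)
  ultimately obtain W where W: "P W" and max: "\<And>W'. P W' \<Longrightarrow> card W' \<le> card W"
    using ex_has_greatest_nat[of P "{r}" card "Suc (card (verts T))"] by (meson less_imp_le)
  have sub: "W \<subseteq> verts T" and built: "leaf_built W {e \<in> edges T. e \<subseteq> W}"
    using W by (auto simp: P_def)
  have "W = verts T"
  proof (rule ccontr)
    assume "W \<noteq> verts T"
    then obtain b where b: "b \<in> verts T" "b \<notin> W" using sub by blast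
    obtain a where a: "a \<in> W" using leaf_built_wf[OF built] by blast
    obtain xs where xs: "xs \<noteq> []" "hd xs = a" "last xs = b" "subgraph (list_graph xs) T"
      using conn a b sub unfolding connected_graph_def by blast
    then obtain u v where uv: "{u, v} \<in> path_edges xs" "u \<in> W" "v \<notin> W"
      using path_crosses[of xs W] a b by auto
    then have uvT: "{u, v} \<in> edges T" using xs(4) by (auto simp: subgraph_def edges_list_graph)
    then have vT: "v \<in> verts T" using subsetD[OF edges uvT] by (auto simp: doubleton_eq_iff)
    \<comment> \<open>A second neighbour of \<open>v\<close> in \<open>W\<close> would close a cycle.\<close>
    have unique: "w = u" if w: "w \<in> W" "{w, v} \<in> edges T" for w
    proof (rule ccontr)
      assume "w \<noteq> u"
      obtain ys where ys: "ys \<noteq> []" "distinct ys" "hd ys = u" "last ys = w" "set ys \<subseteq> W"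
        "path_edges ys \<subseteq> {e \<in> edges T. e \<subseteq> W}"
        using leaf_built_connected[OF built uv(2) w(1)] by blast
      define H where "H = \<lparr>verts = set (ys @ [v]),
        edges = insert {last (ys @ [v]), hd (ys @ [v])} (edges (list_graph (ys @ [v])))\<rparr>"
      \<comment> \<open>Since \<open>u\<close> and \<open>w\<close> differ, the closed list has at
        least the three vertices that \<open>is_cycle\<close> demands.\<close>
      have "2 \<le> length ys" using ys \<open>w \<noteq> u\<close> by (cases ys rule: path_edges.cases) auto
      then have "is_cycle H" unfolding is_cycle_def H_def using ys uv
        by (intro exI[of _ "ys @ [v]"]) auto
      moreover have "subgraph H T" unfolding subgraph_def H_def edges_list_graph
        using ys sub w uvT vT by (auto simp: path_edges_append insert_commute)
      ultimately show False using acyclic by blast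
    qed
    \<comment> \<open>An edge new to the induced subgraph joins \<open>v\<close> to a vertex of
      \<open>W\<close>, which is \<open>u\<close> by \<open>unique\<close>.\<close>
    have "{e \<in> edges T. e \<subseteq> insert v W} = insert {u, v} {e \<in> edges T. e \<subseteq> W}"
    proof
      show "{e \<in> edges T. e \<subseteq> insert v W} \<subseteq> insert {u, v} {e \<in> edges T. e \<subseteq> W}"
      proof
        fix e assume e: "e \<in> {e \<in> edges T. e \<subseteq> insert v W}"
        then obtain c d where cd: "e = {c, d}" "c \<noteq> d" using edges by blast
        show "e \<in> insert {u, v} {e \<in> edges T. e \<subseteq> W}"
          using e cd unique[of c] unique[of d] by (auto simp: insert_commute)
      qed
    qed (use uv uvT in auto)
    then have "P (insert v W)"
      using leaf_built.leaf[OF built uv(2,3)] vT sub by (simp add: P_def)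
    then have "card (insert v W) \<le> card W" using max by blast
    then show False using uv(3) finite_subset[OF sub fin] by simp
  qed
  moreover have "{e \<in> edges T. e \<subseteq> verts T} = edges T" using edges by auto
  ultimately show ?thesis using built by simp
qed

section \<open>Edges and odd vertices of the product\<close>

text \<open>Takes a vertex set and an edge set, in the manner of \<open>leaf_built\<close>, so that
  the induction over leaves applies directly.\<close>

definition grid_edges :: "nat \<Rightarrow> 'a set \<Rightarrow> 'a set set \<Rightarrow> (nat \<times> 'a) set set" where
  "grid_edges n V F = {Pair i ` e |i e. i < n \<and> e \<in> F} \<union>
     {{(i, w), (Suc i, w)} |i w. Suc i < n \<and> w \<in> V}"

text \<open>In the product, \<open>(i, w)\<close> has the degree of \<open>w\<close> plus 2 for an inner row, plus 1 for an outer one.\<close>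

definition grid_odd :: "nat \<Rightarrow> 'a set \<Rightarrow> 'a set set \<Rightarrow> (nat \<times> 'a) set" where
  "grid_odd n V F = {(i, w). i < n \<and> w \<in> V \<and>
     (odd (card {e \<in> F. w \<in> e}) \<longleftrightarrow> 0 < i \<and> Suc i < n)}"

lemma path_graph_edges: "edges (path_graph n) = (\<lambda>i. {i, Suc i}) ` {..<n - 1}"
  using path_edges_map_upt[of id 0 n]
  by (simp add: path_graph_def edges_list_graph atLeast0LessThan)

lemma cartesian_product_edgeI:
  assumes "(a, b) \<in> verts G \<times> verts H" "(c, d) \<in> verts G \<times> verts H"
    and "{a, c} \<in> edges G \<and> b = d \<or> {b, d} \<in> edges H \<and> a = c"
  shows "{(a, b), (c, d)} \<in> edges (cartesian_product G H)"
  unfolding cartesian_product_def ugraph.select_convs using assms by blast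

lemma cartesian_grid_edges:
  assumes "simple_graph T"
  shows "edges (cartesian_product (path_graph n) T) = grid_edges n (verts T) (edges T)"
proof -
  have V: "verts (path_graph n) = {..<n}" by (auto simp: path_graph_def)
  have T: "edges T \<subseteq> {{u, v} |u v. u \<in> verts T \<and> v \<in> verts T \<and> u \<noteq> v}"
    using assms by (simp add: simple_graph_def)
  show ?thesis (is "?A = ?B")
  proof
    show "?A \<subseteq> ?B"
    proof
      fix f assume "f \<in> ?A"
      then obtain a b c d where f: "f = {(a, b), (c, d)}" "a < n" "b \<in> verts T" "c < n"
        "{a, c} \<in> edges (path_graph n) \<and> b = d \<or> {b, d} \<in> edges T \<and> a = c"
        unfolding cartesian_product_def V by auto
      from f(5) show "f \<in> ?B"
      proof
        assume *: "{a, c} \<in> edges (path_graph n) \<and> b = d"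
        then have "c = Suc a \<or> a = Suc c" by (auto simp: path_graph_edges doubleton_eq_iff)
        then have "f = {(a, b), (Suc a, b)} \<and> Suc a < n \<or> f = {(c, b), (Suc c, b)} \<and> Suc c < n"
          using f * by auto
        then show ?thesis using f(3) unfolding grid_edges_def by blast
      next
        assume "{b, d} \<in> edges T \<and> a = c"
        moreover then have "f = Pair a ` {b, d}" using f(1) by simp
        ultimately show ?thesis using f(2) unfolding grid_edges_def by blast
      qed
    qed
    show "?B \<subseteq> ?A"
    proof
      fix f assume "f \<in> ?B"
      then consider i e where "f = Pair i ` e" "i < n" "e \<in> edges T"
        | i w where "f = {(i, w), (Suc i, w)}" "Suc i < n" "w \<in> verts T"
        unfolding grid_edges_def by blast
      then show "f \<in> ?A"
      proof cases
        case 1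
        then obtain a b where "e = {a, b}" "a \<in> verts T" "b \<in> verts T" using T by blast
        with 1 have f: "f = {(i, a), (i, b)}" "(i, a) \<in> {..<n} \<times> verts T"
          "(i, b) \<in> {..<n} \<times> verts T" "{a, b} \<in> edges T" by auto
        with 1 show ?thesis using cartesian_product_edgeI[of i a "path_graph n" T i b] V by metis
      next
        case (2 i w)
        then have "(i, w) \<in> {..<n} \<times> verts T" "(Suc i, w) \<in> {..<n} \<times> verts T"
          "{i, Suc i} \<in> edges (path_graph n)" by (auto simp: path_graph_edges)
        with 2(1) show ?thesis
          using cartesian_product_edgeI[of i w "path_graph n" T "Suc i" w] V by metis
      qed
    qed
  qed
qed

lemma simple_cartesian:
  assumes "simple_graph T"
  shows "simple_graph (cartesian_product (path_graph n) T)"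
proof -
  let ?V = "verts (path_graph n) \<times> verts T"
  have T: "edges T \<subseteq> {{u, v} |u v. u \<in> verts T \<and> v \<in> verts T \<and> u \<noteq> v}" "finite (verts T)"
    using assms by (auto simp: simple_graph_def)
  have 1: "a \<noteq> b" if "{a, b} \<in> edges (path_graph n)" for a b
    using that by (auto simp: path_graph_edges doubleton_eq_iff)
  have 2: "a \<noteq> b" if "{a, b} \<in> edges T" for a b
    using subsetD[OF T(1) that] by (auto simp: doubleton_eq_iff)
  have "f \<in> {{x, y} |x y. x \<in> ?V \<and> y \<in> ?V \<and> x \<noteq> y}"
    if f: "f \<in> edges (cartesian_product (path_graph n) T)" for f
  proof -
    obtain a b c d where "f = {(a, b), (c, d)}" "(a, b) \<in> ?V" "(c, d) \<in> ?V"
      and adj: "{a, c} \<in> edges (path_graph n) \<and> b = d \<or> {b, d} \<in> edges T \<and> a = c"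
      using f unfolding cartesian_product_def ugraph.select_convs by blast
    moreover from adj have "(a, b) \<noteq> (c, d)" using 1[of a c] 2[of b d] by auto
    ultimately show ?thesis by blast
  qed
  moreover have "verts (cartesian_product (path_graph n) T) = ?V" "finite ?V"
    using T(2) by (simp_all add: cartesian_product_def path_graph_def)
  ultimately show ?thesis unfolding simple_graph_def by (simp only: subsetI)
qed

lemma grid_edges_leaf:
  "grid_edges n (insert v V) (insert {u, v} F) = grid_edges n V F \<union>
     (\<lambda>i. {(i, u), (i, v)}) ` {..<n} \<union> (\<lambda>i. {(i, v), (Suc i, v)}) ` {..<n - 1}"
    (is "?A = ?B \<union> ?R \<union> ?C")
proof -
  have "?R = {Pair i ` {u, v} |i. i < n}" by auto
  moreover have "?C = {{(i, v), (Suc i, v)} |i. Suc i < n}" by auto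
  moreover have "{Pair i ` e |i e. i < n \<and> e \<in> insert {u, v} F} =
      {Pair i ` e |i e. i < n \<and> e \<in> F} \<union> {Pair i ` {u, v} |i. i < n}"
    by blast
  moreover have "{{(i, w), (Suc i, w)} |i w. Suc i < n \<and> w \<in> insert v V} =
      {{(i, w), (Suc i, w)} |i w. Suc i < n \<and> w \<in> V} \<union> {{(i, v), (Suc i, v)} |i. Suc i < n}"
    by blast
  ultimately show ?thesis unfolding grid_edges_def by (simp only: Un_ac)
qed

text \<open>In every row the new edge flips the parity at \<open>u\<close>. The leaf
  \<open>v\<close> has degree 1 in the tree, hence degree 3 in inner rows and 2 in outer rows of the
  product.\<close>

lemma grid_odd_leaf:
  assumes "leaf_built V F" "u \<in> V" "v \<notin> V"
  shows "grid_odd n (insert v V) (insert {u, v} F) =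
    {(i, w) \<in> grid_odd n V F. w \<noteq> u} \<union> {(i, u) |i. i < n \<and> (i, u) \<notin> grid_odd n V F} \<union>
    {(i, v) |i. 0 < i \<and> Suc i < n}"
proof -
  have F: "finite F" "\<And>e. e \<in> F \<Longrightarrow> e \<subseteq> V" using leaf_built_wf[OF assms(1)] by auto
  have new: "{u, v} \<notin> F" using F(2)[of "{u, v}"] assms(3) by auto
  have "u \<noteq> v" using assms by auto
  have "{e \<in> insert {u, v} F. u \<in> e} = insert {u, v} {e \<in> F. u \<in> e}" by auto
  then have u: "card {e \<in> insert {u, v} F. u \<in> e} = Suc (card {e \<in> F. u \<in> e})"
    using F new by simp
  have "{e \<in> insert {u, v} F. v \<in> e} = {{u, v}}" using F(2) assms(3) by auto
  then have v: "card {e \<in> insert {u, v} F. v \<in> e} = 1" by simp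
  have w: "{e \<in> insert {u, v} F. w \<in> e} = {e \<in> F. w \<in> e}" if "w \<noteq> u" "w \<noteq> v" for w
    using that by auto
  have *: "(i, x) \<in> grid_odd n (insert v V) (insert {u, v} F) \<longleftrightarrow>
    (i, x) \<in> grid_odd n V F \<and> x \<noteq> u \<or> x = u \<and> i < n \<and> (i, u) \<notin> grid_odd n V F \<or>
    x = v \<and> 0 < i \<and> Suc i < n" for i x
  proof -
    consider "x = u" | "x = v" | "x \<noteq> u" "x \<noteq> v" by blast
    then show ?thesis
    proof cases
      case 1
      then show ?thesis using u \<open>u \<noteq> v\<close> assms by (auto simp: grid_odd_def)
    next
      case 2
      then show ?thesis using v \<open>u \<noteq> v\<close> assms by (auto simp: grid_odd_def)
    next
      case 3
      then show ?thesis using w[OF 3] by (simp add: grid_odd_def)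
    qed
  qed
  show ?thesis
  proof (rule set_eqI)
    fix p :: "nat \<times> 'a"
    obtain i x where p: "p = (i, x)" by (cases p)
    show "p \<in> grid_odd n (insert v V) (insert {u, v} F) \<longleftrightarrow>
      p \<in> {(i, w) \<in> grid_odd n V F. w \<noteq> u} \<union> {(i, u) |i. i < n \<and> (i, u) \<notin> grid_odd n V F} \<union>
        {(i, v) |i. 0 < i \<and> Suc i < n}"
      unfolding p * by blast
  qed
qed

section \<open>Extending the path system by the column of a new leaf\<close>

lemma linked_grid_leaf:
  assumes built: "leaf_built V F" and u: "u \<in> V" and v: "v \<notin> V" and n: "4 \<le> n"
    and linked: "linked (grid_edges n V F) (grid_odd n V F)"
  shows "linked (grid_edges n (insert v V) (insert {u, v} F))
    (grid_odd n (insert v V) (insert {u, v} F))"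
proof -
  define B where "B = grid_edges n V F"
  define S where "S = grid_odd n V F"
  define rung where "rung = (\<lambda>i :: nat. {(i, u), (i, v)})"
  define rail where "rail = (\<lambda>i :: nat. {(i, v), (Suc i, v)})"
  have B: "linked B S" using linked by (simp add: B_def S_def)
  have "u \<noteq> v" using u v by auto
  have F: "e \<subseteq> V" if "e \<in> F" for e using leaf_built_wf[OF built] that by auto
  \<comment> \<open>No old edge meets column \<open>v\<close>; hence all rungs and rails are new
    edges.\<close>
  have fresh: "(i, v) \<notin> \<Union>B" for i
    using F v by (auto simp: B_def grid_edges_def)
  have S: "(i, v) \<notin> S" for i using v by (auto simp: S_def grid_odd_def)
  have notin: "rung i \<notin> B" "rail i \<notin> B" for i
    using fresh[of i] by (auto simp: rung_def rail_def)
  have inj: "rung i = rung j \<longleftrightarrow> i = j" "rail i = rail j \<longleftrightarrow> i = j" "rung i \<noteq> rail j" "rail j \<noteq> rung i"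
    for i j using \<open>u \<noteq> v\<close> by (auto simp: rung_def rail_def doubleton_eq_iff)
  have edges: "grid_edges n (insert v V) (insert {u, v} F) = B \<union> rung ` {..<n} \<union> rail ` {..<n - 1}"
    unfolding grid_edges_leaf B_def rung_def rail_def ..
  have odd: "grid_odd n (insert v V) (insert {u, v} F) = {(i, w) \<in> S. w \<noteq> u} \<union>
      {(i, u) |i. i < n \<and> (i, u) \<notin> S} \<union> {(i, v) |i. 0 < i \<and> Suc i < n}"
    unfolding grid_odd_leaf[OF built u v] S_def ..
  have col: "path_edges (map (\<lambda>i. (i, v)) [a..<b]) = rail ` {a..<b - 1}" for a b
    unfolding path_edges_map_upt rail_def ..
  define f where "f = (\<lambda>p :: nat \<times> 'a. (fst p, v))"
  have f: "f ` (\<lambda>i. (i, u)) ` I = (\<lambda>i. (i, v)) ` I"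
    "(\<lambda>x. {x, f x}) ` (\<lambda>i. (i, u)) ` I = rung ` I"
    "inj_on f ((\<lambda>i. (i, u)) ` I)" for I
    by (auto simp: f_def image_image rung_def inj_on_def)
  show ?thesis
  proof (cases "odd (card {e \<in> F. u \<in> e})")
    case True
    then have Su: "(i, u) \<in> S \<longleftrightarrow> 0 < i \<and> Suc i < n" for i
      using u by (auto simp: S_def grid_odd_def)
    define I where "I = {1..<n - 1}"
    have I: "i \<in> I \<longleftrightarrow> 0 < i \<and> Suc i < n" for i by (auto simp: I_def)
    define A where "A = (\<lambda>i. (i, u)) ` I"
    have fA: "f ` A = (\<lambda>i. (i, v)) ` I" "(\<lambda>x. {x, f x}) ` A = rung ` I" "inj_on f A"
      unfolding A_def by (rule f)+
    have "A \<subseteq> S" by (auto simp: A_def Su I)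
    moreover have "f ` A \<inter> (\<Union>B \<union> A) = {}"
      unfolding fA(1) unfolding A_def using fresh \<open>u \<noteq> v\<close> by auto
    moreover have "finite A" by (simp add: A_def I_def)
    ultimately have 1: "linked (B \<union> rung ` I) ((\<lambda>i. (i, v)) ` I \<union> (S - A))"
      using linked_extend_many[OF _ B _ fA(3)] unfolding fA(1,2) by blast
    define xs where "xs = (0, u) # map (\<lambda>i. (i, v)) [0..<n] @ [(n - 1, u)]"
    have xs: "path_edges xs = {rung 0} \<union> rail ` {..<n - 1} \<union> {rung (n - 1)}"
    proof -
      let ?ys = "map (\<lambda>i. (i, v)) [0..<n]"
      have ys: "?ys \<noteq> []" "hd ?ys = (0, v)" "last ?ys = (n - 1, v)"
        using n by (auto simp: hd_map last_map)
      have "path_edges (?ys @ [(n - 1, u)]) = rail ` {..<n - 1} \<union> {rung (n - 1)}"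
        unfolding path_edges_append[OF ys(1)] ys(3) col
        by (simp add: rung_def insert_commute atLeast0LessThan)
      then show ?thesis
        unfolding xs_def using path_edges_Cons[of "?ys @ [(n - 1, u)]" "(0, u)"] ys
        by (simp add: rung_def) (simp add: insert_commute)
    qed
    have ends: "path_ends xs = {(0, u), (n - 1, u)}" by (simp add: xs_def path_ends_def)
    have 2: "linked (B \<union> rung ` I \<union> path_edges xs)
        ((\<lambda>i. (i, v)) ` I \<union> (S - A) \<union> path_ends xs)"
    proof (rule linked_add[OF 1])
      show "distinct xs" using n \<open>u \<noteq> v\<close> by (auto simp: xs_def distinct_map inj_on_def)
      show "2 \<le> length xs" by (simp add: xs_def)
      show "path_edges xs \<inter> (B \<union> rung ` I) = {}"
        unfolding xs using notin inj by (auto simp: I)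
      show "path_ends xs \<inter> ((\<lambda>i. (i, v)) ` I \<union> (S - A)) = {}"
        unfolding ends using \<open>u \<noteq> v\<close> by (auto simp: Su)
    qed
    have "{..<n} = {0} \<union> I \<union> {n - 1}" using n by (auto simp: I)
    then have "rung ` {..<n} = {rung 0} \<union> rung ` I \<union> {rung (n - 1)}" by auto
    then have e: "B \<union> rung ` I \<union> path_edges xs = grid_edges n (insert v V) (insert {u, v} F)"
      unfolding edges xs by auto
    \<comment> \<open>In column \<open>u\<close> the ends have moved from the inner rows to the
      outer ones; in column \<open>v\<close> they are the inner rows.\<close>
    have "(i, w) \<in> (\<lambda>i. (i, v)) ` I \<union> (S - A) \<union> path_ends xs \<longleftrightarrow>
        (i, w) \<in> grid_odd n (insert v V) (insert {u, v} F)" for i w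
      using Su[of i] S[of i] \<open>u \<noteq> v\<close> n unfolding odd ends A_def by (auto simp: I)
    then have "(\<lambda>i. (i, v)) ` I \<union> (S - A) \<union> path_ends xs =
        grid_odd n (insert v V) (insert {u, v} F)" by (simp add: set_eq_iff del: Un_iff)
    with 2 e show ?thesis by simp
  next
    case False
    then have Su: "(i, u) \<in> S \<longleftrightarrow> i = 0 \<or> i = n - 1" for i
      using u n by (auto simp: S_def grid_odd_def)
    have "linked (B \<union> path_edges ((0, u) # [(0, v), (1, v)]))
        (insert (last [(0, v), (1, v)]) (S - {(0, u)}))"
      by (rule linked_extend[OF B]) (use Su fresh in auto)
    then have 1: "linked (B \<union> {rung 0, rail 0}) (insert (1, v) (S - {(0, u)}))"
      by (simp add: rung_def rail_def)
    \<comment> \<open>Column \<open>v\<close> is cut at \<open>rail 1\<close>: the first path took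
      rows 0 and 1, and this one runs from row \<open>n - 1\<close> back to row 2.\<close>
    define ys where "ys = map (\<lambda>i. (i, v)) (rev [2..<n])"
    have ys: "ys \<noteq> []" "hd ys = (n - 1, v)" "last ys = (2, v)" "distinct ys"
      "set ys = (\<lambda>i. (i, v)) ` {2..<n}"
      using n by (auto simp: ys_def hd_map last_map hd_rev last_rev distinct_map inj_on_def)
    have ys_edges: "path_edges ((n - 1, u) # ys) = insert (rung (n - 1)) (rail ` {2..<n - 1})"
      using path_edges_Cons[OF ys(1), of "(n - 1, u)"] ys(2)
      by (simp add: ys_def rev_map[symmetric] path_edges_rev col rung_def)
    \<comment> \<open>The path ending at \<open>(n - 1, u)\<close> may be the one just prolonged;
      \<open>linked_extend\<close> covers this, because \<open>linked\<close> records only the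
      ends.\<close>
    have 2: "linked (B \<union> {rung 0, rail 0} \<union> insert (rung (n - 1)) (rail ` {2..<n - 1}))
        (insert (2, v) (insert (1, v) (S - {(0, u)}) - {(n - 1, u)}))"
      unfolding ys_edges[symmetric] ys(3)[symmetric]
    proof (rule linked_extend[OF 1])
      show "(n - 1, u) \<in> insert (1, v) (S - {(0, u)})" using Su n by auto
      show "set ys \<inter> \<Union>(B \<union> {rung 0, rail 0}) = {}"
        unfolding ys(5) using fresh \<open>u \<noteq> v\<close> by (auto simp: rung_def rail_def)
    qed (use ys in auto)
    have p_edges: "path_edges [(1, u), (1, v), (2, v), (2, u)] = {rung 1, rail 1, rung 2}"
      by (simp add: rung_def rail_def insert_commute numeral_2_eq_2)
    have p_ends: "path_ends [(1, u), (1, v), (2, v), (2, u)] = {(1 :: nat, u), (2, u)}"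
      by (simp add: path_ends_def)
    have 3: "linked (B \<union> {rung 0, rail 0} \<union> insert (rung (n - 1)) (rail ` {2..<n - 1}) \<union>
          {rung 1, rail 1, rung 2})
        (insert (2, v) (insert (1, v) (S - {(0, u)}) - {(n - 1, u)}) \<union> {(1, u), (2, u)})"
      unfolding p_edges[symmetric] p_ends[symmetric]
    proof (rule linked_add[OF 2])
      show "path_edges [(1, u), (1, v), (2, v), (2, u)] \<inter>
          (B \<union> {rung 0, rail 0} \<union> insert (rung (n - 1)) (rail ` {2..<n - 1})) = {}"
        unfolding p_edges using notin inj n by auto
      show "path_ends [(1, u), (1, v), (2, v), (2, u)] \<inter>
          insert (2, v) (insert (1, v) (S - {(0, u)}) - {(n - 1, u)}) = {}"
        unfolding p_ends using Su n \<open>u \<noteq> v\<close> by auto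
    qed (use \<open>u \<noteq> v\<close> in auto)
    \<comment> \<open>The inner rows left over; there are none when \<open>n = 4\<close>.\<close>
    define A where "A = (\<lambda>i. (i, u)) ` {3..<n - 1}"
    have fA: "f ` A = (\<lambda>i. (i, v)) ` {3..<n - 1}" "(\<lambda>x. {x, f x}) ` A = rung ` {3..<n - 1}" "inj_on f A"
      unfolding A_def by (rule f)+
    let ?E = "B \<union> {rung 0, rail 0} \<union> insert (rung (n - 1)) (rail ` {2..<n - 1}) \<union>
          {rung 1, rail 1, rung 2}"
    let ?S = "insert (2, v) (insert (1, v) (S - {(0, u)}) - {(n - 1, u)}) \<union> {(1, u), (2, u)}"
    have 4: "linked (?E \<union> rung ` {3..<n - 1}) (?S \<union> A \<union> (\<lambda>i. (i, v)) ` {3..<n - 1})"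
      unfolding fA(1,2)[symmetric]
    proof (rule linked_add_many[OF _ 3 fA(3)])
      show "f ` A \<inter> A = {}" unfolding fA(1) unfolding A_def using \<open>u \<noteq> v\<close> by auto
      show "(A \<union> f ` A) \<inter> ?S = {}" unfolding fA(1) unfolding A_def using S n \<open>u \<noteq> v\<close> by (auto simp: Su)
      show "(\<lambda>x. {x, f x}) ` A \<inter> ?E = {}" unfolding fA(2) using notin inj by auto
    qed (simp add: A_def)
    have "{..<n} = {0, 1, 2, n - 1} \<union> {3..<n - 1}" "{..<n - 1} = {0, 1} \<union> {2..<n - 1}"
      using n by auto
    then have "rung ` {..<n} = {rung 0, rung 1, rung 2, rung (n - 1)} \<union> rung ` {3..<n - 1}"
      "rail ` {..<n - 1} = {rail 0, rail 1} \<union> rail ` {2..<n - 1}" by auto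
    then have e: "?E \<union> rung ` {3..<n - 1} = grid_edges n (insert v V) (insert {u, v} F)"
      unfolding edges by auto
    \<comment> \<open>In both columns \<open>u\<close> and \<open>v\<close> the ends are now exactly
      the inner rows, collected as row 1, row 2 and the rows from 3 to \<open>n - 2\<close>.\<close>
    have "(i, w) \<in> ?S \<union> A \<union> (\<lambda>i. (i, v)) ` {3..<n - 1} \<longleftrightarrow>
        (i, w) \<in> grid_odd n (insert v V) (insert {u, v} F)" for i w
    proof -
      have mem: "(j, y) \<in> (\<lambda>i. (i, x)) ` J \<longleftrightarrow> y = x \<and> j \<in> J"
        for j :: nat and x y :: 'a and J by auto
      consider "w = u" | "w = v" | "w \<noteq> u" "w \<noteq> v" by blast
      then show ?thesis
      proof cases
        case 1
        then have "(i, w) \<in> ?S \<union> A \<union> (\<lambda>i. (i, v)) ` {3..<n - 1} \<longleftrightarrow>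
            i = 1 \<or> i = 2 \<or> 3 \<le> i \<and> i < n - 1"
          using Su[of i] \<open>u \<noteq> v\<close> by (simp add: A_def mem) blast
        moreover have "(i, w) \<in> grid_odd n (insert v V) (insert {u, v} F) \<longleftrightarrow>
            i < n \<and> i \<noteq> 0 \<and> i \<noteq> n - 1"
          using 1 Su[of i] \<open>u \<noteq> v\<close> by (simp add: odd)
        moreover have "i = 1 \<or> i = 2 \<or> 3 \<le> i \<and> i < n - 1 \<longleftrightarrow> i < n \<and> i \<noteq> 0 \<and> i \<noteq> n - 1"
          using n by presburger
        ultimately show ?thesis by (simp only:)
      next
        case 2
        then have "(i, w) \<in> ?S \<union> A \<union> (\<lambda>i. (i, v)) ` {3..<n - 1} \<longleftrightarrow>
            i = 1 \<or> i = 2 \<or> 3 \<le> i \<and> i < n - 1"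
          using S[of i] \<open>u \<noteq> v\<close> by (simp add: A_def mem) blast
        moreover have "(i, w) \<in> grid_odd n (insert v V) (insert {u, v} F) \<longleftrightarrow> 0 < i \<and> Suc i < n"
          using 2 S[of i] \<open>u \<noteq> v\<close> by (simp add: odd)
        moreover have "i = 1 \<or> i = 2 \<or> 3 \<le> i \<and> i < n - 1 \<longleftrightarrow> 0 < i \<and> Suc i < n"
          using n by presburger
        ultimately show ?thesis by (simp only:)
      next
        case 3
        then show ?thesis by (simp add: odd A_def mem)
      qed
    qed
    then have "?S \<union> A \<union> (\<lambda>i. (i, v)) ` {3..<n - 1} = grid_odd n (insert v V) (insert {u, v} F)"
      by (simp add: set_eq_iff del: Un_iff insert_iff)
    with 4 e show ?thesis by simp
  qed
qed

text \<open>Induction over leaf additions. Over a single vertex the grid is itself one path, with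
  its ends in the two outer rows.\<close>

lemma linked_grid:
  assumes "leaf_built V F" "4 \<le> n"
  shows "linked (grid_edges n V F) (grid_odd n V F)"
  using assms(1)
proof induction
  case (single x)
  let ?xs = "map (\<lambda>i. (i, x)) [0..<n]"
  have "linked ({} \<union> path_edges ?xs) ({} \<union> path_ends ?xs)"
  proof (rule linked_add[OF linked_empty])
    show "distinct ?xs" by (simp add: distinct_map inj_on_def)
    show "2 \<le> length ?xs" using assms(2) by simp
  qed simp_all
  moreover have "path_edges ?xs = grid_edges n {x} {}"
  proof -
    have "path_edges ?xs = {{(i, x), (Suc i, x)} |i. Suc i < n}"
      unfolding path_edges_map_upt by auto
    then show ?thesis by (simp add: grid_edges_def)
  qed
  moreover have "path_ends ?xs = grid_odd n {x} {}"
  proof -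
    have "path_ends ?xs = {(0, x), (n - 1, x)}"
      using assms(2) by (simp add: path_ends_def hd_map last_map)
    \<comment> \<open>The tree degree is 0 here, so the odd vertices are those outside the inner
      rows.\<close>
    moreover have mem: "(i, w) \<in> grid_odd n {x} {} \<longleftrightarrow> (i, w) \<in> {(0, x), (n - 1, x)}" for i w
    proof -
      have "i < n \<and> \<not> (0 < i \<and> Suc i < n) \<longleftrightarrow> i = 0 \<or> i = n - 1"
        using assms(2) by presburger
      then show ?thesis by (cases "w = x") (simp_all add: grid_odd_def)
    qed
    have "grid_odd n {x} {} = {(0, x), (n - 1, x)}"
      by (rule set_eqI) (simp only: split_paired_all mem)
    ultimately show ?thesis by (simp only:)
  qed
  ultimately show ?case by simp
next
  case (leaf V F u v)
  show ?case by (rule linked_grid_leaf[OF leaf.hyps assms(2) leaf.IH])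
qed

theorem theorem5p2:
  fixes T :: "'a ugraph" and n :: nat
  assumes "tree T" and "n \<ge> 4"
  shows "real (path_number (cartesian_product (path_graph n) T)) =
         real (num_odd (cartesian_product (path_graph n) T)) / 2"
proof -
  have T: "simple_graph T" using assms(1) by (simp add: tree_def)
  have "linked (edges (cartesian_product (path_graph n) T)) (grid_odd n (verts T) (edges T))"
    unfolding cartesian_grid_edges[OF T] by (rule linked_grid[OF tree_leaf_built[OF assms(1)] assms(2)])
  from path_number_linked[OF simple_cartesian[OF T] this]
  show ?thesis by linarith
qed

end
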